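(* Let $L\ge2$ be an integer and $\langle z\rangle:=\sin\big(\frac{\pi z}{L+1}\big)$. The operators, for $a\in\mathbb{Z}+b$, $$T^{\mathrm{tri}}_A(a)=\frac{\sqrt{\langle a-1\rangle\langle a+1\rangle}}{\langle a\rangle}E_{21}\otimes E_{12}+\frac{\sqrt{\langle a+1\rangle\langle a-1\rangle}}{\langle a\rangle}E_{12}\otimes E_{21}+\frac{\langle a+1\rangle}{\langle a\rangle}E_{11}\otimes E_{22}+\frac{\langle a-1\rangle}{\langle a\rangle}E_{22}\otimes E_{11}$$ form a local dynamical Temperley--Lieb operator on $V^{\pi_A^{\mathrm{unres}}}$ associated with the constant function $\bar\kappa^{\mathrm{tri}}=2\cos\lambda$, $\lambda=\pi/(L+1)$.
   Context: Fix a generic $b\in\mathbb{C}$ (so that $\langle a\rangle\ne0$ for all $a\in\mathbb{Z}+b$). $\pi_A^{\mathrm{unres}}$ is the groupoid of the unoriented graph with vertex set $\mathbb{Z}+b$ and one edge between any two neighbouring numbers: its objects are the vertices, each edge gives two mutually inverse arrows, and all arrows are compositions of these. Write $(a,\pm1)$ for the arrow from $a$ to $a\pm1$. $V=V^{\pi_A^{\mathrm{unres}}}$ is the graded vector space with $V_{(a,-1)}=\mathbb{C}e_{(a,-1)}$, $V_{(a,+1)}=\mathbb{C}e_{(a,+1)}$ for all objects $a$, all other components zero. Tensor products: $(V\otimes W)_\gamma=\bigoplus_{\beta\circ\alpha=\gamma}V_\alpha\otimes W_\beta$ ($\beta\circ\alpha$ defined when $t(\alpha)=s(\beta)$, where $s,t$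 denote source and target). For each $a$ the source fiber $\bigoplus_{\alpha\in s^{-1}(a)}(V\otimes V)_\alpha$ is identified with $\mathbb{C}^2\otimes\mathbb{C}^2$ by $e_{(a,\varepsilon_1)}\otimes e_{(a+\varepsilon_1,\varepsilon_2)}\mapsto e_{i_1}\otimes e_{i_2}$, with $i=1$ for $\varepsilon=+1$ and $i=2$ for $\varepsilon=-1$; $E_{ij}$ is the $2\times2$ matrix unit, $E_{ij}e_k=\delta_{jk}e_i$. The same square root is used in both off-diagonal entries. For a family $X(a)\in\bigoplus_{\alpha\in s^{-1}(a)}\mathrm{End}_{\mathbb{C}}((V\otimes V)_\alpha)$ and $u\otimes v\otimes w\in V_{\alpha_1}\otimes V_{\alpha_2}\otimes V_{\alpha_3}$ with composable arrows and $s(\alpha_1)=a$, set $X^{(12)}(a)(u\otimes v\otimes w)=X(a)(u\otimes v)\otimes w$ and $X^{(23)}(ah^{(1)})(u\otimes v\otimes w)=u\otimes X(t(\alpha_1))(v\otimes w)$. A local dynamical Temperley--Lieb operator on $V$ associated to $\bar\kappa:\mathrm{Ob}(\pi)\to\mathbb{C}\setminus\{0\}$ is a family $T(a)\in\bigoplus_{\alpha\in s^{-1}(a)}\mathrm{End}_{\mathbb{C}}((V\otimes V)_\alpha)$ such that for all $a$: $T(a)T(a)=\bar\kappa(a)T(a)$; $T^{(12)}(a)T^{(23)}(ah^{(1)})T^{(12)}(a)=T^{(12)}(a)$; $T^{(23)}(ah^{(1)})T^{(12)}(a)T^{(23)}(ah^{(1)})=T^{(23)}(ah^{(1)})$. 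*)

theory Defs
  imports "HOL-Analysis.Analysis" "HOL-Library.Poly_Mapping"
begin

section \<open>Groupoids, and the groupoid of an unoriented graph\<close>

text \<open>\<^term>\<open>cmp G \<beta> \<alpha>\<close> is the composition written \<open>\<beta> \<circ> \<alpha>\<close>: first \<open>\<alpha>\<close>, then \<open>\<beta>\<close>.
  It is meaningful if the target of \<open>\<alpha>\<close> is the source of \<open>\<beta>\<close>.\<close>

record ('o, 'r) groupoid =
  Ob :: "'o set"
  Arr :: "'r set"
  src :: "'r \<Rightarrow> 'o"
  tgt :: "'r \<Rightarrow> 'o"
  cmp :: "'r \<Rightarrow> 'r \<Rightarrow> 'r"
  idn :: "'o \<Rightarrow> 'r"

locale groupoid =
  fixes G :: "('o, 'r) groupoid"
  assumes src_in: "\<alpha> \<in> Arr G \<Longrightarrow> src G \<alpha> \<in> Ob G"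
    and tgt_in: "\<alpha> \<in> Arr G \<Longrightarrow> tgt G \<alpha> \<in> Ob G"
    and cmp_in: "\<lbrakk>\<alpha> \<in> Arr G; \<beta> \<in> Arr G; tgt G \<alpha> = src G \<beta>\<rbrakk> \<Longrightarrow>
        cmp G \<beta> \<alpha> \<in> Arr G \<and> src G (cmp G \<beta> \<alpha>) = src G \<alpha> \<and> tgt G (cmp G \<beta> \<alpha>) = tgt G \<beta>"
    and cmp_assoc: "\<lbrakk>\<alpha> \<in> Arr G; \<beta> \<in> Arr G; \<gamma> \<in> Arr G; tgt G \<alpha> = src G \<beta>; tgt G \<beta> = src G \<gamma>\<rbrakk> \<Longrightarrow>
        cmp G \<gamma> (cmp G \<beta> \<alpha>) = cmp G (cmp G \<gamma> \<beta>) \<alpha>"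
    and idn_in: "a \<in> Ob G \<Longrightarrow> idn G a \<in> Arr G \<and> src G (idn G a) = a \<and> tgt G (idn G a) = a"
    and cmp_idn: "\<alpha> \<in> Arr G \<Longrightarrow> cmp G \<alpha> (idn G (src G \<alpha>)) = \<alpha> \<and> cmp G (idn G (tgt G \<alpha>)) \<alpha> = \<alpha>"
    and inv_ex: "\<alpha> \<in> Arr G \<Longrightarrow> \<exists>\<beta>\<in>Arr G. src G \<beta> = tgt G \<alpha> \<and> tgt G \<beta> = src G \<alpha> \<and>
        cmp G \<beta> \<alpha> = idn G (src G \<alpha>) \<and> cmp G \<alpha> \<beta> = idn G (tgt G \<alpha>)"

text \<open>A simple unoriented graph is given by its vertices \<open>U\<close> and its edges \<open>E\<close>, a set of
  two-element sets. A walk is the nonempty list of its successive vertices. Arrows of the groupoid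
  are walks modulo the relations saying that the two arrows \<open>u \<rightarrow> v\<close> and \<open>v \<rightarrow> u\<close>
  of every edge are inverse to each other.\<close>

definition walks :: "'v set \<Rightarrow> 'v set set \<Rightarrow> 'v list set" where
  "walks U E = {p. p \<noteq> [] \<and> set p \<subseteq> U \<and> successively (\<lambda>u v. {u, v} \<in> E) p}"

definition cancel :: "'v set \<Rightarrow> 'v set set \<Rightarrow> 'v list rel" where
  "cancel U E = {(p, q). p \<in> walks U E \<and> q \<in> walks U E \<and>
     (\<exists>xs u v ys. p = xs @ [u, v, u] @ ys \<and> q = xs @ [u] @ ys)}"

definition homotopic :: "'v set \<Rightarrow> 'v set set \<Rightarrow> 'v list rel" where
  "homotopic U E = (cancel U E \<union> (cancel U E)\<inverse>)\<^sup>*"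

definition walk_arrow :: "'v set \<Rightarrow> 'v set set \<Rightarrow> 'v list \<Rightarrow> 'v list set" where
  "walk_arrow U E p = homotopic U E `` {p}"

definition graph_groupoid :: "'v set \<Rightarrow> 'v set set \<Rightarrow> ('v, 'v list set) groupoid" where
  "graph_groupoid U E =
     \<lparr>Ob = U,
      Arr = walk_arrow U E ` walks U E,
      src = (\<lambda>\<alpha>. the_elem (hd ` \<alpha>)),
      tgt = (\<lambda>\<alpha>. the_elem (last ` \<alpha>)),
      cmp = (\<lambda>\<beta> \<alpha>. \<Union>p\<in>\<alpha>. \<Union>q\<in>\<beta>. walk_arrow U E (p @ tl q)),
      idn = (\<lambda>v. walk_arrow U E [v])\<rparr>"

section \<open>Graded vector spaces\<close>

text \<open>A complex vector space graded by the arrows of a groupoid is given by a homogeneous basis,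
  each basis element having an arrow as its degree. Vectors are finitely supported
  coefficient functions \<^typ>\<open>'i \<Rightarrow>\<^sub>0 complex\<close> supported in the basis.\<close>

record ('i, 'r) graded_space =
  basis :: "'i set"
  deg :: "'i \<Rightarrow> 'r"

definition component :: "('i, 'r) graded_space \<Rightarrow> 'r \<Rightarrow> ('i \<Rightarrow>\<^sub>0 complex) set" where
  "component W \<alpha> = {x. Poly_Mapping.keys x \<subseteq> {i \<in> basis W. deg W i = \<alpha>}}"

text \<open>The direct sum of the components over all arrows with source \<open>a\<close>.\<close>

definition source_fiber ::
    "('o, 'r) groupoid \<Rightarrow> ('i, 'r) graded_space \<Rightarrow> 'o \<Rightarrow> ('i \<Rightarrow>\<^sub>0 complex) set" where
  "source_fiber G W a = {x. Poly_Mapping.keys x \<subseteq> {i \<in> basis W. deg W i \<in> Arr G \<and> src G (deg W i) = a}}"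

definition tensor ::
    "('o, 'r) groupoid \<Rightarrow> ('i, 'r) graded_space \<Rightarrow> ('j, 'r) graded_space \<Rightarrow> ('i \<times> 'j, 'r) graded_space" where
  "tensor G V W =
     \<lparr>basis = {(i, j). i \<in> basis V \<and> j \<in> basis W \<and> tgt G (deg V i) = src G (deg W j)},
      deg = (\<lambda>(i, j). cmp G (deg W j) (deg V i))\<rparr>"

definition scale :: "complex \<Rightarrow> ('i \<Rightarrow>\<^sub>0 complex) \<Rightarrow> ('i \<Rightarrow>\<^sub>0 complex)" where
  "scale c x = Poly_Mapping.map ((*) c) x"

definition basis_vec :: "'i \<Rightarrow> ('i \<Rightarrow>\<^sub>0 complex)" where
  "basis_vec i = Poly_Mapping.single i 1"

definition tensor_vec :: "('i \<Rightarrow>\<^sub>0 complex) \<Rightarrow> ('j \<Rightarrow>\<^sub>0 complex) \<Rightarrow> ('i \<times> 'j \<Rightarrow>\<^sub>0 complex)" where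
  "tensor_vec x y = (\<Sum>i\<in>Poly_Mapping.keys x. \<Sum>j\<in>Poly_Mapping.keys y.
     Poly_Mapping.single (i, j) (Poly_Mapping.lookup x i * Poly_Mapping.lookup y j))"

text \<open>The identification of \<open>(U \<otimes> V) \<otimes> W\<close> with \<open>U \<otimes> (V \<otimes> W)\<close>.\<close>

definition reassoc :: "(('i \<times> 'j) \<times> 'k \<Rightarrow>\<^sub>0 complex) \<Rightarrow> ('i \<times> 'j \<times> 'k \<Rightarrow>\<^sub>0 complex)" where
  "reassoc x = (\<Sum>((i, j), k)\<in>Poly_Mapping.keys x.
     Poly_Mapping.single (i, j, k) (Poly_Mapping.lookup x ((i, j), k)))"

definition linear_on_sub ::
    "('i \<Rightarrow>\<^sub>0 complex) set \<Rightarrow> (('i \<Rightarrow>\<^sub>0 complex) \<Rightarrow> ('i \<Rightarrow>\<^sub>0 complex)) \<Rightarrow> bool" where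
  "linear_on_sub S X \<longleftrightarrow>
     (\<forall>x\<in>S. \<forall>y\<in>S. X (x + y) = X x + X y) \<and> (\<forall>c. \<forall>x\<in>S. X (scale c x) = scale c (X x))"

text \<open>The direct sum of the spaces \<open>End(W\<^sub>\<alpha>)\<close> over all arrows \<open>\<alpha>\<close> with source \<open>a\<close>, realised as operators
  on the source fiber; only their values on the source fiber are relevant. The last clause expresses
  that an element of a direct sum has finitely many nonzero components.\<close>

definition fiber_End ::
    "('o, 'r) groupoid \<Rightarrow> ('i, 'r) graded_space \<Rightarrow> 'o \<Rightarrow> (('i \<Rightarrow>\<^sub>0 complex) \<Rightarrow> ('i \<Rightarrow>\<^sub>0 complex)) set" where
  "fiber_End G W a = {X. linear_on_sub (source_fiber G W a) X \<and>
     (\<forall>\<alpha>\<in>Arr G. src G \<alpha> = a \<longrightarrow> X ` component W \<alpha> \<subseteq> component W \<alpha>) \<and>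
     finite {\<alpha> \<in> Arr G. src G \<alpha> = a \<and> (\<exists>x\<in>component W \<alpha>. X x \<noteq> 0)}}"

section \<open>Local dynamical Temperley--Lieb operators\<close>

text \<open>Linear extensions of
  \<open>X\<^sup>(\<^sup>1\<^sup>2\<^sup>)(a) (u \<otimes> v \<otimes> w) = X(a)(u \<otimes> v) \<otimes> w\<close> and
  \<open>X\<^sup>(\<^sup>2\<^sup>3\<^sup>)(ah\<^sup>(\<^sup>1\<^sup>)) (u \<otimes> v \<otimes> w) = u \<otimes> X(t(\<alpha>\<^sub>1))(v \<otimes> w)\<close>, \<open>u\<close> of degree \<open>\<alpha>\<^sub>1\<close>,
  from basis vectors. The formulas for arbitrary vectors are \<open>act12_tensor\<close> and
  \<open>act23_tensor\<close> below.\<close>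

definition act12 ::
    "('o \<Rightarrow> ('i \<times> 'i \<Rightarrow>\<^sub>0 complex) \<Rightarrow> ('i \<times> 'i \<Rightarrow>\<^sub>0 complex)) \<Rightarrow> 'o \<Rightarrow>
     ('i \<times> 'i \<times> 'i \<Rightarrow>\<^sub>0 complex) \<Rightarrow> ('i \<times> 'i \<times> 'i \<Rightarrow>\<^sub>0 complex)" where
  "act12 X a x = (\<Sum>(i, j, k)\<in>Poly_Mapping.keys x. scale (Poly_Mapping.lookup x (i, j, k))
     (reassoc (tensor_vec (X a (tensor_vec (basis_vec i) (basis_vec j))) (basis_vec k))))"

definition act23 ::
    "('o, 'r) groupoid \<Rightarrow> ('i, 'r) graded_space \<Rightarrow>
     ('o \<Rightarrow> ('i \<times> 'i \<Rightarrow>\<^sub>0 complex) \<Rightarrow> ('i \<times> 'i \<Rightarrow>\<^sub>0 complex)) \<Rightarrow>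
     ('i \<times> 'i \<times> 'i \<Rightarrow>\<^sub>0 complex) \<Rightarrow> ('i \<times> 'i \<times> 'i \<Rightarrow>\<^sub>0 complex)" where
  "act23 G V X x = (\<Sum>(i, j, k)\<in>Poly_Mapping.keys x. scale (Poly_Mapping.lookup x (i, j, k))
     (tensor_vec (basis_vec i) (X (tgt G (deg V i)) (tensor_vec (basis_vec j) (basis_vec k)))))"

definition local_dynamical_TL ::
    "('o, 'r) groupoid \<Rightarrow> ('i, 'r) graded_space \<Rightarrow> ('o \<Rightarrow> complex) \<Rightarrow>
     ('o \<Rightarrow> ('i \<times> 'i \<Rightarrow>\<^sub>0 complex) \<Rightarrow> ('i \<times> 'i \<Rightarrow>\<^sub>0 complex)) \<Rightarrow> bool" where
  "local_dynamical_TL G V \<kappa> T \<longleftrightarrow>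
     (\<forall>a\<in>Ob G. \<kappa> a \<noteq> 0) \<and>
     (\<forall>a\<in>Ob G. T a \<in> fiber_End G (tensor G V V) a) \<and>
     (\<forall>a\<in>Ob G. \<forall>x\<in>source_fiber G (tensor G V V) a. T a (T a x) = scale (\<kappa> a) (T a x)) \<and>
     (\<forall>a\<in>Ob G. \<forall>x\<in>source_fiber G (tensor G V (tensor G V V)) a.
        act12 T a (act23 G V T (act12 T a x)) = act12 T a x \<and>
        act23 G V T (act12 T a (act23 G V T x)) = act23 G V T x)"

section \<open>The unrestricted groupoid of type A and the trigonometric operator\<close>

definition shifted_ints :: "complex \<Rightarrow> complex set" where
  "shifted_ints b = {of_int n + b |n. True}"

definition neighbour_edges :: "complex \<Rightarrow> complex set set" where
  "neighbour_edges b = {{a, a + 1} |a. a \<in> shifted_ints b}"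

definition pi_A_unres :: "complex \<Rightarrow> (complex, complex list set) groupoid" where
  "pi_A_unres b = graph_groupoid (shifted_ints b) (neighbour_edges b)"

text \<open>The index \<open>(a, \<epsilon>)\<close> with \<open>\<epsilon> = \<plusminus>1\<close> stands for the basis vector \<open>e\<^bsub>(a,\<epsilon>)\<^esub>\<close>, whose degree is the
  arrow from \<open>a\<close> to \<open>a + \<epsilon>\<close>.\<close>

definition V_A_unres :: "complex \<Rightarrow> (complex \<times> int, complex list set) graded_space" where
  "V_A_unres b =
     \<lparr>basis = shifted_ints b \<times> {1, -1},
      deg = (\<lambda>(a, \<epsilon>). walk_arrow (shifted_ints b) (neighbour_edges b) [a, a + of_int \<epsilon>])\<rparr>"

definition bracket :: "nat \<Rightarrow> complex \<Rightarrow> complex" where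
  "bracket L z = sin (of_real pi * z / (of_nat L + 1))"

text \<open>\<open>\<complex>\<^sup>2\<close> is \<^typ>\<open>complex^2\<close>; its indices are \<open>1\<close> and \<open>2\<close> (note that \<open>2 = 0\<close> in the type \<^typ>\<open>2\<close>).
  \<open>\<complex>\<^sup>2 \<otimes> \<complex>\<^sup>2\<close> is \<^typ>\<open>complex^(2 \<times> 2)\<close>, with \<open>e\<^sub>i \<otimes> e\<^sub>j\<close> the basis vector of index \<open>(i, j)\<close>.\<close>

definition mat_unit :: "2 \<Rightarrow> 2 \<Rightarrow> complex^2^2" where
  "mat_unit i j = (\<chi> k l. if k = i \<and> l = j then 1 else 0)"

definition kron :: "complex^2^2 \<Rightarrow> complex^2^2 \<Rightarrow> complex^(2 \<times> 2)^(2 \<times> 2)" where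
  "kron A B = (\<chi> p q. A $ fst p $ fst q * B $ snd p $ snd q)"

definition mat_scale :: "complex \<Rightarrow> complex^'n^'m \<Rightarrow> complex^'n^'m" where
  "mat_scale c A = (\<chi> p q. c * A $ p $ q)"

definition eps :: "2 \<Rightarrow> int" where
  "eps i = (if i = 1 then 1 else -1)"

definition path_index :: "complex \<Rightarrow> 2 \<times> 2 \<Rightarrow> (complex \<times> int) \<times> (complex \<times> int)" where
  "path_index a p = ((a, eps (fst p)), (a + of_int (eps (fst p)), eps (snd p)))"

text \<open>The operator on the source fiber of \<open>V \<otimes> V\<close> at \<open>a\<close> corresponding to a matrix under the
  identification \<open>e\<^bsub>(a,\<epsilon>\<^sub>1)\<^esub> \<otimes> e\<^bsub>(a+\<epsilon>\<^sub>1,\<epsilon>\<^sub>2)\<^esub> \<mapsto> e\<^bsub>i\<^sub>1\<^esub> \<otimes> e\<^bsub>i\<^sub>2\<^esub>\<close>.\<close>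

definition fiber_to_vec ::
    "complex \<Rightarrow> ((complex \<times> int) \<times> (complex \<times> int) \<Rightarrow>\<^sub>0 complex) \<Rightarrow> complex^(2 \<times> 2)" where
  "fiber_to_vec a x = (\<chi> p. Poly_Mapping.lookup x (path_index a p))"

definition vec_to_fiber ::
    "complex \<Rightarrow> complex^(2 \<times> 2) \<Rightarrow> ((complex \<times> int) \<times> (complex \<times> int) \<Rightarrow>\<^sub>0 complex)" where
  "vec_to_fiber a v = (\<Sum>p\<in>UNIV. Poly_Mapping.single (path_index a p) (v $ p))"

definition fiber_operator ::
    "complex \<Rightarrow> complex^(2 \<times> 2)^(2 \<times> 2) \<Rightarrow>
     ((complex \<times> int) \<times> (complex \<times> int) \<Rightarrow>\<^sub>0 complex) \<Rightarrow> ((complex \<times> int) \<times> (complex \<times> int) \<Rightarrow>\<^sub>0 complex)" where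
  "fiber_operator a M x = vec_to_fiber a (M *v fiber_to_vec a x)"

text \<open>The argument \<open>r\<close> supplies the chosen square root \<open>r a\<close> of
  \<open>\<langle>a - 1\<rangle>\<langle>a + 1\<rangle>\<close>, which is used in both off-diagonal entries.\<close>

definition T_tri :: "nat \<Rightarrow> (complex \<Rightarrow> complex) \<Rightarrow> complex \<Rightarrow>
    ((complex \<times> int) \<times> (complex \<times> int) \<Rightarrow>\<^sub>0 complex) \<Rightarrow> ((complex \<times> int) \<times> (complex \<times> int) \<Rightarrow>\<^sub>0 complex)" where
  "T_tri L r a = fiber_operator a
     (mat_scale (r a / bracket L a) (kron (mat_unit 2 1) (mat_unit 1 2)) +
      mat_scale (r a / bracket L a) (kron (mat_unit 1 2) (mat_unit 2 1)) +
      mat_scale (bracket L (a + 1) / bracket L a) (kron (mat_unit 1 1) (mat_unit 2 2)) +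
      mat_scale (bracket L (a - 1) / bracket L a) (kron (mat_unit 2 2) (mat_unit 1 1)))"

section \<open>Consistency facts\<close>

lemma homotopic_refl: "(p, p) \<in> homotopic U E"
  unfolding homotopic_def by simp

lemma homotopic_sym: "(p, q) \<in> homotopic U E \<Longrightarrow> (q, p) \<in> homotopic U E"
  unfolding homotopic_def by (rule symD[OF sym_rtrancl[OF sym_Un_converse]])

lemma homotopic_trans: "(p, q) \<in> homotopic U E \<Longrightarrow> (q, r) \<in> homotopic U E \<Longrightarrow> (p, r) \<in> homotopic U E"
  unfolding homotopic_def by simp

lemma walk_arrow_eq_iff: "walk_arrow U E p = walk_arrow U E q \<longleftrightarrow> (p, q) \<in> homotopic U E"
proof
  assume "walk_arrow U E p = walk_arrow U E q"
  then have "q \<in> homotopic U E `` {p}" unfolding walk_arrow_def using homotopic_refl[of q U E] by simp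
  then show "(p, q) \<in> homotopic U E" by simp
next
  assume h: "(p, q) \<in> homotopic U E"
  show "walk_arrow U E p = walk_arrow U E q"
  proof (rule set_eqI)
    fix s show "s \<in> walk_arrow U E p \<longleftrightarrow> s \<in> walk_arrow U E q"
      unfolding walk_arrow_def Image_singleton_iff
      by (rule iffI) (erule homotopic_trans[OF homotopic_sym[OF h]], erule homotopic_trans[OF h])
  qed
qed

lemma homotopic_step: "(p, q) \<in> cancel U E \<Longrightarrow> (p, q) \<in> homotopic U E"
  unfolding homotopic_def by (rule r_into_rtrancl) simp

lemma homotopic_props:
  assumes "(p, q) \<in> homotopic U E" "p \<in> walks U E"
  shows "q \<in> walks U E \<and> hd q = hd p \<and> last q = last p"
  using assms(1) unfolding homotopic_def
proof (induction rule: rtrancl_induct)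
  case base then show ?case using assms(2) by simp
next
  case (step y z)
  have "(y, z) \<in> cancel U E \<or> (z, y) \<in> cancel U E" using step.hyps(2) by auto
  then have "z \<in> walks U E \<and> hd z = hd y \<and> last z = last y"
    unfolding cancel_def by (auto simp: hd_append split: if_splits)
  then show ?case using step.IH by simp
qed

lemma walk_append:
  assumes "p \<in> walks U E" "q \<in> walks U E" "last p = hd q"
  shows "p @ tl q \<in> walks U E"
proof -
  obtain v q' where q: "q = v # q'" using assms(2) by (cases q) (auto simp: walks_def)
  then show ?thesis using assms by (auto simp: walks_def successively_append_iff successively_Cons)
qed

lemma cancel_append_right:
  assumes "(p, p') \<in> cancel U E" "q \<in> walks U E" "last p = hd q"
  shows "(p @ tl q, p' @ tl q) \<in> cancel U E"
proof -
  obtain xs u v ys where *: "p = xs @ [u, v, u] @ ys" "p' = xs @ [u] @ ys" "p \<in> walks U E" "p' \<in> walks U E"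
    using assms(1) unfolding cancel_def by auto
  have "last p' = last p" using * by simp
  then have w: "p @ tl q \<in> walks U E" "p' @ tl q \<in> walks U E" using * assms walk_append by metis+
  have "p @ tl q = xs @ [u, v, u] @ (ys @ tl q)" "p' @ tl q = xs @ [u] @ (ys @ tl q)" using * by auto
  then show ?thesis using w unfolding cancel_def by blast
qed

lemma cancel_append_left:
  assumes "(q, q') \<in> cancel U E" "p \<in> walks U E" "last p = hd q"
  shows "(p @ tl q, p @ tl q') \<in> cancel U E"
proof -
  obtain xs u v ys where *: "q = xs @ [u, v, u] @ ys" "q' = xs @ [u] @ ys" "q \<in> walks U E" "q' \<in> walks U E"
    using assms(1) unfolding cancel_def by auto
  have "hd q' = hd q" using * by (cases xs) auto
  then have w: "p @ tl q \<in> walks U E" "p @ tl q' \<in> walks U E" using * assms walk_append by metis+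
  have glue: "p @ tl s = butlast p @ s" if "s \<noteq> []" "last p = hd s" for s
  proof -
    have "p \<noteq> []" using assms(2) by (simp add: walks_def)
    then show ?thesis using that by (cases p rule: rev_cases; cases s) auto
  qed
  have "p @ tl q = butlast p @ q" "p @ tl q' = butlast p @ q'"
    using * assms(3) \<open>hd q' = hd q\<close> by (auto intro!: glue)
  then have "p @ tl q = (butlast p @ xs) @ [u, v, u] @ ys" "p @ tl q' = (butlast p @ xs) @ [u] @ ys"
    using * by auto
  then show ?thesis using w unfolding cancel_def by blast
qed

lemma homotopic_append_right:
  assumes "(p, p') \<in> homotopic U E" "p \<in> walks U E" "q \<in> walks U E" "last p = hd q"
  shows "(p @ tl q, p' @ tl q) \<in> homotopic U E"
  using assms(1) unfolding homotopic_def
proof (induction rule: rtrancl_induct)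
  case base show ?case by simp
next
  case (step y z)
  have "(p, y) \<in> homotopic U E" "(p, z) \<in> homotopic U E"
    using step.hyps rtrancl_into_rtrancl[OF step.hyps] unfolding homotopic_def by simp_all
  then have "last y = hd q" "last z = hd q" using homotopic_props assms by metis+
  then have "(y @ tl q, z @ tl q) \<in> cancel U E \<union> (cancel U E)\<inverse>"
    using step.hyps(2) cancel_append_right assms(3) by (metis Un_iff converse_iff)
  then show ?case using step.IH by (rule rtrancl_into_rtrancl[rotated])
qed

lemma homotopic_append_left:
  assumes "(q, q') \<in> homotopic U E" "p \<in> walks U E" "q \<in> walks U E" "last p = hd q"
  shows "(p @ tl q, p @ tl q') \<in> homotopic U E"
  using assms(1) unfolding homotopic_def
proof (induction rule: rtrancl_induct)
  case base show ?case by simp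
next
  case (step y z)
  have "(q, y) \<in> homotopic U E" "(q, z) \<in> homotopic U E"
    using step.hyps rtrancl_into_rtrancl[OF step.hyps] unfolding homotopic_def by simp_all
  then have "hd y = hd q" "hd z = hd q" using homotopic_props assms by metis+
  then have "(p @ tl y, p @ tl z) \<in> cancel U E \<union> (cancel U E)\<inverse>"
    using step.hyps(2) cancel_append_left assms by (metis Un_iff converse_iff)
  then show ?case using step.IH by (rule rtrancl_into_rtrancl[rotated])
qed

lemma graph_groupoid_src:
  assumes "p \<in> walks U E" shows "src (graph_groupoid U E) (walk_arrow U E p) = hd p"
proof -
  have "\<forall>q\<in>walk_arrow U E p. hd q = hd p" "p \<in> walk_arrow U E p"
    using homotopic_props[OF _ assms] homotopic_refl[of p U E] unfolding walk_arrow_def by blast+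
  then have "hd ` walk_arrow U E p = {hd p}" by (metis (no_types) image_cong image_constant)
  then show ?thesis by (simp add: graph_groupoid_def)
qed

lemma graph_groupoid_tgt:
  assumes "p \<in> walks U E" shows "tgt (graph_groupoid U E) (walk_arrow U E p) = last p"
proof -
  have "\<forall>q\<in>walk_arrow U E p. last q = last p" "p \<in> walk_arrow U E p"
    using homotopic_props[OF _ assms] homotopic_refl[of p U E] unfolding walk_arrow_def by blast+
  then have "last ` walk_arrow U E p = {last p}" by (metis (no_types) image_cong image_constant)
  then show ?thesis by (simp add: graph_groupoid_def)
qed

lemma graph_groupoid_cmp:
  assumes "p \<in> walks U E" "q \<in> walks U E" "last p = hd q"
  shows "cmp (graph_groupoid U E) (walk_arrow U E q) (walk_arrow U E p) = walk_arrow U E (p @ tl q)"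
proof -
  have "walk_arrow U E (p' @ tl q') = walk_arrow U E (p @ tl q)"
    if "p' \<in> walk_arrow U E p" "q' \<in> walk_arrow U E q" for p' q'
  proof -
    have h: "(p, p') \<in> homotopic U E" "(q, q') \<in> homotopic U E" using that by (auto simp: walk_arrow_def)
    have w: "p' \<in> walks U E" "last p' = hd q" using homotopic_props[OF h(1) assms(1)] assms(3) by auto
    have "(p @ tl q, p' @ tl q) \<in> homotopic U E" using homotopic_append_right[OF h(1)] assms by simp
    moreover have "(p' @ tl q, p' @ tl q') \<in> homotopic U E" using homotopic_append_left[OF h(2)] w assms by simp
    ultimately show ?thesis using homotopic_trans homotopic_sym walk_arrow_eq_iff by metis
  qed
  moreover have "p \<in> walk_arrow U E p" "q \<in> walk_arrow U E q" by (auto simp: walk_arrow_def homotopic_refl)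
  ultimately have "(\<Union>p'\<in>walk_arrow U E p. \<Union>q'\<in>walk_arrow U E q. walk_arrow U E (p' @ tl q')) = walk_arrow U E (p @ tl q)"
    by blast
  then show ?thesis by (simp add: graph_groupoid_def)
qed

lemma walks_rev: "p \<in> walks U E \<Longrightarrow> rev p \<in> walks U E"
  by (simp add: walks_def insert_commute)

lemma walk_cancel_rev: "p \<in> walks U E \<Longrightarrow> (p @ tl (rev p), [hd p]) \<in> homotopic U E"
proof (induction p rule: rev_induct)
  case Nil then show ?case by (simp add: walks_def)
next
  case (snoc v p)
  show ?case
  proof (cases "p = []")
    case True then show ?thesis by (simp add: homotopic_refl)
  next
    case False
    then obtain xs u where p: "p = xs @ [u]" by (metis append_butlast_last_id)
    have pw: "p \<in> walks U E" using snoc.prems False by (auto simp: walks_def successively_append_iff)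
    have big: "(p @ [v]) @ tl (rev (p @ [v])) \<in> walks U E"
      by (rule walk_append[OF snoc.prems walks_rev[OF snoc.prems]]) simp
    have small: "p @ tl (rev p) \<in> walks U E"
      by (rule walk_append[OF pw walks_rev[OF pw]]) (simp add: False hd_rev)
    have "(p @ [v]) @ tl (rev (p @ [v])) = xs @ [u, v, u] @ rev xs" "p @ tl (rev p) = xs @ [u] @ rev xs"
      using p by auto
    then have "((p @ [v]) @ tl (rev (p @ [v])), p @ tl (rev p)) \<in> cancel U E"
      using big small unfolding cancel_def by blast
    then show ?thesis using snoc.IH[OF pw] homotopic_step homotopic_trans False by (metis hd_append2)
  qed
qed

lemma groupoid_graph_groupoid: "groupoid (graph_groupoid U E)"
proof -
  let ?G = "graph_groupoid U E" and ?w = "walk_arrow U E"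
  have arr: "Arr ?G = ?w ` walks U E" and ob: "Ob ?G = U" and idn: "idn ?G v = ?w [v]" for v
    by (auto simp: graph_groupoid_def)
  note simps = graph_groupoid_src graph_groupoid_tgt graph_groupoid_cmp
  have ends: "p \<noteq> []" "hd p \<in> U" "last p \<in> U" if "p \<in> walks U E" for p
    using that by (auto simp: walks_def)
  have single: "[v] \<in> walks U E" if "v \<in> U" for v using that by (simp add: walks_def)
  have comp_ends: "hd (p @ tl q) = hd p \<and> last (p @ tl q) = last q"
    if pq: "p \<in> walks U E" "q \<in> walks U E" "last p = hd q" for p q
  proof -
    obtain v q' where "q = v # q'" using ends(1)[OF pq(2)] by (cases q) auto
    then show ?thesis using pq(3) ends(1)[OF pq(1)] by auto
  qed
  show ?thesis
  proof
    fix \<alpha> assume "\<alpha> \<in> Arr ?G"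
    then obtain p where p: "\<alpha> = ?w p" "p \<in> walks U E" using arr by auto
    show "src ?G \<alpha> \<in> Ob ?G" "tgt ?G \<alpha> \<in> Ob ?G" using p ends by (simp_all add: simps ob)
    have i: "[hd p] \<in> walks U E" "[last p] \<in> walks U E" using p ends single by auto
    have e: "[hd p] @ tl p = p" using ends[OF p(2)] by simp
    show "cmp ?G \<alpha> (idn ?G (src ?G \<alpha>)) = \<alpha> \<and> cmp ?G (idn ?G (tgt ?G \<alpha>)) \<alpha> = \<alpha>"
      using p i e by (simp add: simps idn)
    have r: "rev p \<in> walks U E" "hd (rev p) = last p" "last (rev p) = hd p"
      using p(2) walks_rev ends[OF p(2)] by (auto simp: hd_rev last_rev)
    have "?w (p @ tl (rev p)) = ?w [hd p]" using walk_cancel_rev[OF p(2)] by (simp add: walk_arrow_eq_iff)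
    moreover have "?w (rev p @ tl p) = ?w [last p]"
      using walk_cancel_rev[OF r(1)] r by (simp add: walk_arrow_eq_iff)
    ultimately show "\<exists>\<beta>\<in>Arr ?G. src ?G \<beta> = tgt ?G \<alpha> \<and> tgt ?G \<beta> = src ?G \<alpha> \<and>
        cmp ?G \<beta> \<alpha> = idn ?G (src ?G \<alpha>) \<and> cmp ?G \<alpha> \<beta> = idn ?G (tgt ?G \<alpha>)"
      using p r by (intro bexI[of _ "?w (rev p)"]) (simp_all add: simps idn arr)
  next
    fix \<alpha> \<beta> assume "\<alpha> \<in> Arr ?G" "\<beta> \<in> Arr ?G" and t: "tgt ?G \<alpha> = src ?G \<beta>"
    then obtain p q where p: "\<alpha> = ?w p" "p \<in> walks U E" and q: "\<beta> = ?w q" "q \<in> walks U E" using arr by auto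
    have l: "last p = hd q" using t p q by (simp add: simps)
    show "cmp ?G \<beta> \<alpha> \<in> Arr ?G \<and> src ?G (cmp ?G \<beta> \<alpha>) = src ?G \<alpha> \<and> tgt ?G (cmp ?G \<beta> \<alpha>) = tgt ?G \<beta>"
      using p q l walk_append[OF p(2) q(2) l] comp_ends[OF p(2) q(2) l] by (simp add: simps arr)
  next
    fix \<alpha> \<beta> \<gamma> assume "\<alpha> \<in> Arr ?G" "\<beta> \<in> Arr ?G" "\<gamma> \<in> Arr ?G"
      and t: "tgt ?G \<alpha> = src ?G \<beta>" "tgt ?G \<beta> = src ?G \<gamma>"
    then obtain p q r where p: "\<alpha> = ?w p" "p \<in> walks U E" and q: "\<beta> = ?w q" "q \<in> walks U E"
      and r: "\<gamma> = ?w r" "r \<in> walks U E" using arr by auto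
    have l: "last p = hd q" "last q = hd r" using t p q r by (simp_all add: simps)
    have pq: "p @ tl q \<in> walks U E" "last (p @ tl q) = hd r"
      using walk_append comp_ends p q l by auto
    have qr: "q @ tl r \<in> walks U E" "last p = hd (q @ tl r)"
      using walk_append comp_ends q r l by auto
    have "p @ tl (q @ tl r) = (p @ tl q) @ tl r" using ends[OF q(2)] by simp
    then show "cmp ?G \<gamma> (cmp ?G \<beta> \<alpha>) = cmp ?G (cmp ?G \<gamma> \<beta>) \<alpha>"
      using graph_groupoid_cmp[OF p(2) q(2) l(1)] graph_groupoid_cmp[OF q(2) r(2) l(2)]
        graph_groupoid_cmp[OF pq(1) r(2) pq(2)] graph_groupoid_cmp[OF p(2) qr] by (simp add: p q r)
  next
    fix a assume "a \<in> Ob ?G"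
    then show "idn ?G a \<in> Arr ?G \<and> src ?G (idn ?G a) = a \<and> tgt ?G (idn ?G a) = a"
      using single[of a] by (simp add: simps ob idn arr)
  qed
qed

lemma groupoid_pi_A_unres: "groupoid (pi_A_unres b)"
  unfolding pi_A_unres_def by (rule groupoid_graph_groupoid)

lemma mult_if_0:
  "c * (if P then d else 0) = (if P then c * d else 0)" "(if P then d else 0) * c = (if P then d * c else 0)"
  for c d :: complex
  by simp_all

lemma lookup_scale: "Poly_Mapping.lookup (scale c x) i = c * Poly_Mapping.lookup x i"
  unfolding scale_def by (simp add: Poly_Mapping.map.rep_eq when_def)

lemma lookup_basis_vec: "Poly_Mapping.lookup (basis_vec i) j = (if j = i then 1 else 0)"
  unfolding basis_vec_def by (auto simp: lookup_single when_def)

lemma lookup_tensor_vec: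
  "Poly_Mapping.lookup (tensor_vec x y) (i, j) = Poly_Mapping.lookup x i * Poly_Mapping.lookup y j"
proof -
  have "Poly_Mapping.lookup (tensor_vec x y) (i, j) =
      (\<Sum>k\<in>Poly_Mapping.keys x. \<Sum>l\<in>Poly_Mapping.keys y.
        if k = i then if l = j then Poly_Mapping.lookup x k * Poly_Mapping.lookup y l else 0 else 0)"
    unfolding tensor_vec_def by (auto simp: lookup_sum lookup_single when_def intro!: sum.cong)
  also have "\<dots> = (\<Sum>k\<in>Poly_Mapping.keys x. if k = i then Poly_Mapping.lookup x k * Poly_Mapping.lookup y j else 0)"
    by (intro sum.cong refl) (auto simp: sum.delta in_keys_iff)
  also have "\<dots> = Poly_Mapping.lookup x i * Poly_Mapping.lookup y j"
    by (auto simp: sum.delta in_keys_iff)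
  finally show ?thesis .
qed

lemma lookup_reassoc: "Poly_Mapping.lookup (reassoc x) (i, j, k) = Poly_Mapping.lookup x ((i, j), k)"
proof -
  have "Poly_Mapping.lookup (reassoc x) (i, j, k) =
      (\<Sum>t\<in>Poly_Mapping.keys x. if t = ((i, j), k) then Poly_Mapping.lookup x t else 0)"
    unfolding reassoc_def lookup_sum by (intro sum.cong refl) (auto simp: lookup_single when_def split: if_splits)
  then show ?thesis by (simp add: sum.delta in_keys_iff)
qed

lemma keys_tensor_vec:
  "Poly_Mapping.keys (tensor_vec x y) = Poly_Mapping.keys x \<times> Poly_Mapping.keys y"
  by (auto simp: in_keys_iff lookup_tensor_vec)

lemma basis_vec_expand: "x = (\<Sum>i\<in>Poly_Mapping.keys x. scale (Poly_Mapping.lookup x i) (basis_vec i))"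
  by (rule poly_mapping_eqI) (simp add: lookup_sum lookup_scale lookup_basis_vec mult_if_0 sum.delta' in_keys_iff)

lemma tensor_basis_vec: "tensor_vec (basis_vec i) (basis_vec j) = basis_vec (i, j)"
  by (rule poly_mapping_eqI) (simp add: split_paired_all lookup_tensor_vec lookup_basis_vec)

lemma sum_Times: "sum F (A \<times> B) = (\<Sum>i\<in>A. \<Sum>j\<in>B. F (i, j))"
  by (simp add: sum.cartesian_product)

lemma linear_on_sub_expand:
  assumes lin: "linear_on_sub {x. Poly_Mapping.keys x \<subseteq> B} X" and x: "Poly_Mapping.keys x \<subseteq> B"
  shows "X x = (\<Sum>i\<in>Poly_Mapping.keys x. scale (Poly_Mapping.lookup x i) (X (basis_vec i)))"
proof -
  let ?S = "{x :: 'a \<Rightarrow>\<^sub>0 complex. Poly_Mapping.keys x \<subseteq> B}"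
  have add: "X (x + y) = X x + X y" if "x \<in> ?S" "y \<in> ?S" for x y
    using lin that unfolding linear_on_sub_def by blast
  have scl: "X (scale c x) = scale c (X x)" if "x \<in> ?S" for x c
    using lin that unfolding linear_on_sub_def by blast
  have z: "scale 0 y = 0" for y :: "'k \<Rightarrow>\<^sub>0 complex" by (rule poly_mapping_eqI) (simp add: lookup_scale)
  have "X (scale 0 0) = scale 0 (X 0)" by (rule scl) auto
  then have X0: "X 0 = 0" by (simp add: z)
  have S: "scale c (basis_vec i) \<in> ?S" "basis_vec i \<in> ?S" if "i \<in> B" for c i
    using that by (auto simp: in_keys_iff lookup_scale lookup_basis_vec split: if_splits)
  have "X (\<Sum>i\<in>K. scale (c i) (basis_vec i)) = (\<Sum>i\<in>K. scale (c i) (X (basis_vec i))) \<and>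
      (\<Sum>i\<in>K. scale (c i) (basis_vec i)) \<in> ?S" if "finite K" "K \<subseteq> B" for K c
    using that
  proof (induction K rule: finite_induct)
    case empty then show ?case by (simp add: X0)
  next
    case (insert k K)
    let ?s = "\<Sum>i\<in>K. scale (c i) (basis_vec i)"
    have IH: "X ?s = (\<Sum>i\<in>K. scale (c i) (X (basis_vec i)))" "?s \<in> ?S" and k: "k \<in> B" using insert by auto
    have "scale (c k) (basis_vec k) + ?s \<in> ?S"
      using IH(2) S(1)[OF k] keys_add[of "scale (c k) (basis_vec k)" ?s] by blast
    moreover have "X (scale (c k) (basis_vec k) + ?s) = X (scale (c k) (basis_vec k)) + X ?s"
      by (rule add[OF S(1)[OF k] IH(2)])
    ultimately show ?case using insert.hyps IH scl[OF S(2)[OF k]] by simp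
  qed
  from this[of "Poly_Mapping.keys x" "Poly_Mapping.lookup x"] show ?thesis
    using x basis_vec_expand[of x] by simp
qed

lemma source_fiber_tensor_vec:
  assumes "groupoid G" "u \<in> component V \<alpha>" "v \<in> component V \<beta>"
    "\<alpha> \<in> Arr G" "\<beta> \<in> Arr G" "tgt G \<alpha> = src G \<beta>" "src G \<alpha> = a"
  shows "tensor_vec u v \<in> source_fiber G (tensor G V V) a"
  using assms groupoid.cmp_in[OF assms(1,4,5,6)]
  unfolding component_def source_fiber_def tensor_def by (auto simp: keys_tensor_vec)

lemma act12_tensor:
  assumes G: "groupoid G" and X: "X a \<in> fiber_End G (tensor G V V) a"
    and u: "u \<in> component V \<alpha>\<^sub>1" and v: "v \<in> component V \<alpha>\<^sub>2"
    and arr: "\<alpha>\<^sub>1 \<in> Arr G" "\<alpha>\<^sub>2 \<in> Arr G" "tgt G \<alpha>\<^sub>1 = src G \<alpha>\<^sub>2" "src G \<alpha>\<^sub>1 = a"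
  shows "act12 X a (tensor_vec u (tensor_vec v w)) = reassoc (tensor_vec (X a (tensor_vec u v)) w)"
proof -
  let ?l = "Poly_Mapping.lookup" and ?k = "Poly_Mapping.keys"
  have lin: "linear_on_sub (source_fiber G (tensor G V V) a) (X a)" using X by (simp add: fiber_End_def)
  have "tensor_vec u v \<in> source_fiber G (tensor G V V) a" by (rule source_fiber_tensor_vec[OF G u v arr])
  then have ex: "X a (tensor_vec u v) = (\<Sum>t\<in>?k u \<times> ?k v. scale (?l (tensor_vec u v) t) (X a (basis_vec t)))"
    using linear_on_sub_expand[OF lin[unfolded source_fiber_def]] unfolding source_fiber_def keys_tensor_vec[symmetric] by blast
  have eq: "?l (act12 X a (tensor_vec u (tensor_vec v w))) (p, q, r) =
      ?l (reassoc (tensor_vec (X a (tensor_vec u v)) w)) (p, q, r)" for p q r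
  proof -
    have "?l (act12 X a (tensor_vec u (tensor_vec v w))) (p, q, r) =
       (\<Sum>i\<in>?k u. \<Sum>j\<in>?k v. \<Sum>k\<in>?k w. if r = k then ?l u i * (?l v j * ?l w k) * ?l (X a (basis_vec (i, j))) (p, q) else 0)"
      unfolding act12_def keys_tensor_vec lookup_sum sum_Times
      by (intro sum.cong refl) (simp add: lookup_scale lookup_reassoc lookup_tensor_vec
          tensor_basis_vec lookup_basis_vec)
    also have "\<dots> = (\<Sum>i\<in>?k u. \<Sum>j\<in>?k v. ?l u i * (?l v j * ?l w r) * ?l (X a (basis_vec (i, j))) (p, q))"
      by (intro sum.cong refl) (simp add: sum.delta' in_keys_iff)
    also have "\<dots> = ?l (X a (tensor_vec u v)) (p, q) * ?l w r"
      unfolding ex lookup_sum sum_Times sum_distrib_right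
      by (intro sum.cong refl) (simp add: lookup_scale lookup_tensor_vec)
    finally show ?thesis
      by (simp add: lookup_reassoc lookup_tensor_vec)
  qed
  show ?thesis by (rule poly_mapping_eqI) (simp only: split_paired_all eq)
qed

lemma act23_tensor:
  assumes G: "groupoid G" and X: "X (tgt G \<alpha>\<^sub>1) \<in> fiber_End G (tensor G V V) (tgt G \<alpha>\<^sub>1)"
    and u: "u \<in> component V \<alpha>\<^sub>1" and v: "v \<in> component V \<alpha>\<^sub>2" and w: "w \<in> component V \<alpha>\<^sub>3"
    and arr: "\<alpha>\<^sub>2 \<in> Arr G" "\<alpha>\<^sub>3 \<in> Arr G" "tgt G \<alpha>\<^sub>2 = src G \<alpha>\<^sub>3" "src G \<alpha>\<^sub>2 = tgt G \<alpha>\<^sub>1"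
  shows "act23 G V X (tensor_vec u (tensor_vec v w)) = tensor_vec u (X (tgt G \<alpha>\<^sub>1) (tensor_vec v w))"
proof -
  let ?l = "Poly_Mapping.lookup" and ?k = "Poly_Mapping.keys" and ?c = "tgt G \<alpha>\<^sub>1"
  have lin: "linear_on_sub (source_fiber G (tensor G V V) ?c) (X ?c)" using X by (simp add: fiber_End_def)
  have "tensor_vec v w \<in> source_fiber G (tensor G V V) ?c" by (rule source_fiber_tensor_vec[OF G v w arr])
  then have ex: "X ?c (tensor_vec v w) = (\<Sum>t\<in>?k v \<times> ?k w. scale (?l (tensor_vec v w) t) (X ?c (basis_vec t)))"
    using linear_on_sub_expand[OF lin[unfolded source_fiber_def]] unfolding source_fiber_def keys_tensor_vec[symmetric] by blast
  have d: "tgt G (deg V i) = ?c" if "i \<in> ?k u" for i using u that by (auto simp: component_def)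
  have eq: "?l (act23 G V X (tensor_vec u (tensor_vec v w))) (p, q) =
      ?l (tensor_vec u (X ?c (tensor_vec v w))) (p, q)" for p q
  proof -
    have "?l (act23 G V X (tensor_vec u (tensor_vec v w))) (p, q) =
       (\<Sum>i\<in>?k u. if p = i then \<Sum>j\<in>?k v. \<Sum>k\<in>?k w. ?l u i * (?l v j * ?l w k) * ?l (X ?c (basis_vec (j, k))) q else 0)"
      unfolding act23_def keys_tensor_vec lookup_sum sum_Times
    proof (intro sum.cong refl)
      fix i assume "i \<in> ?k u"
      then show "(\<Sum>j\<in>?k v. \<Sum>k\<in>?k w. ?l (case (i, j, k) of (i, j, k) \<Rightarrow>
          scale (?l (tensor_vec u (tensor_vec v w)) (i, j, k))
            (tensor_vec (basis_vec i) (X (tgt G (deg V i)) (tensor_vec (basis_vec j) (basis_vec k))))) (p, q)) =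
        (if p = i then \<Sum>j\<in>?k v. \<Sum>k\<in>?k w. ?l u i * (?l v j * ?l w k) * ?l (X ?c (basis_vec (j, k))) q else 0)"
        by (simp add: d lookup_scale lookup_tensor_vec tensor_basis_vec lookup_basis_vec)
    qed
    also have "\<dots> = (\<Sum>j\<in>?k v. \<Sum>k\<in>?k w. ?l u p * (?l v j * ?l w k) * ?l (X ?c (basis_vec (j, k))) q)"
      by (cases "p \<in> ?k u") (simp_all add: sum.delta' in_keys_iff)
    also have "\<dots> = ?l u p * ?l (X ?c (tensor_vec v w)) q"
      unfolding ex by (simp add: lookup_sum lookup_scale lookup_tensor_vec sum_distrib_left
          sum_Times mult_ac)
    finally show ?thesis
      by (simp add: lookup_tensor_vec)
  qed
  show ?thesis by (rule poly_mapping_eqI) (simp only: split_paired_all eq)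
qed

lemma mat_unit_axis: "mat_unit i j *v axis k 1 = (if j = k then axis i 1 else 0)"
proof -
  have "(mat_unit i j *v axis k 1) $ l = (if j = k then axis i 1 else 0) $ l" for l
  proof -
    have "(mat_unit i j *v axis k 1) $ l = (\<Sum>m\<in>UNIV. if m = k then mat_unit i j $ l $ k else 0)"
      unfolding matrix_vector_mult_def vec_lambda_beta by (intro sum.cong refl) (simp add: axis_def)
    then show ?thesis by (simp add: mat_unit_def axis_def)
  qed
  then show ?thesis by (simp add: vec_eq_iff)
qed

lemma vec_to_fiber_axis:
  "vec_to_fiber a (axis p 1) =
     tensor_vec (basis_vec (a, eps (fst p))) (basis_vec (a + of_int (eps (fst p)), eps (snd p)))"
proof -
  have "vec_to_fiber a (axis p 1) = (\<Sum>q\<in>UNIV. if q = p then Poly_Mapping.single (path_index a q) 1 else 0)"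
    unfolding vec_to_fiber_def by (intro sum.cong refl) (auto simp: axis_def)
  then show ?thesis by (simp add: tensor_basis_vec) (simp add: basis_vec_def path_index_def)
qed

end

theory Submission
  imports Defs
begin

text \<open>
  A path of length two from \<open>a\<close> takes two steps, and the matrix of \<open>T(a)\<close> vanishes except on the two
  paths \<open>a \<rightarrow> a + \<epsilon> \<rightarrow> a\<close> that come back to \<open>a\<close>. Both of these have the identity of \<open>a\<close> as their
  degree, so the grading is respected for free and \<open>T(a)\<close> amounts to a \<open>2 \<times> 2\<close> matrix
  \<open>t\<^sub>a(\<epsilon>, \<eta>)\<close> indexed by signs. For an operator of this shape the Temperley--Lieb relations follow
  from three properties of these matrices.

  Rank at most one: \<open>t\<^sub>a(\<epsilon>, \<zeta>) t\<^sub>a(\<zeta>, \<eta>) = t\<^sub>a(\<zeta>, \<zeta>) t\<^sub>a(\<epsilon>, \<eta>)\<close>. Trace: \<open>\<Sum>\<^sub>\<epsilon> t\<^sub>a(\<epsilon>, \<epsilon>) = \<kappa>(a)\<close>; summing the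
  rank condition over \<open>\<zeta>\<close> gives \<open>T\<^sup>2 = \<kappa> T\<close>. Duality: \<open>t\<^sub>a(\<epsilon>, \<epsilon>) t\<^bsub>a+\<epsilon>\<^esub>(-\<epsilon>, -\<epsilon>) = 1\<close>. In the cubic
  relations there is only one way through the middle factor. Between two copies of \<open>T\<^sup>(\<^sup>1\<^sup>2\<^sup>)\<close>, for
  instance, the three steps must be \<open>(\<eta>, -\<eta>, \<eta>)\<close> before and after \<open>T\<^sup>(\<^sup>2\<^sup>3\<^sup>)\<close>, with \<open>\<eta>\<close> the last
  step of the initial path, so the triple product has the coefficient
  \<open>t\<^sub>a(\<epsilon>, \<eta>) t\<^bsub>a+\<eta>\<^esub>(-\<eta>, -\<eta>) t\<^sub>a(\<eta>, \<xi>)\<close>, which is \<open>t\<^sub>a(\<epsilon>, \<xi>)\<close> by the rank and duality conditions.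
  This is \<open>local_dynamical_TL_loop_operator\<close>.

  For the trigonometric operator the diagonal entries are \<open>\<langle>a + \<epsilon>\<rangle> / \<langle>a\<rangle>\<close>, so duality is the
  cancellation of \<open>\<langle>a\<rangle>\<close> and \<open>\<langle>a + \<epsilon>\<rangle>\<close>; the rank condition is \<open>r(a)\<^sup>2 = \<langle>a - 1\<rangle>\<langle>a + 1\<rangle>\<close>; and the
  trace is the addition theorem \<open>\<langle>a + 1\<rangle> + \<langle>a - 1\<rangle> = 2 cos \<lambda> \<langle>a\<rangle>\<close>.
\<close>

section \<open>Operators on the paths that return to their source\<close>

abbreviation signs :: "int set" where
  "signs \<equiv> {1, -1}"

definition loop :: "complex \<Rightarrow> int \<Rightarrow> (complex \<times> int) \<times> (complex \<times> int)" where
  "loop a \<epsilon> = ((a, \<epsilon>), (a + of_int \<epsilon>, - \<epsilon>))"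

definition loop_operator ::
    "(complex \<Rightarrow> int \<Rightarrow> int \<Rightarrow> complex) \<Rightarrow> complex \<Rightarrow>
     ((complex \<times> int) \<times> (complex \<times> int) \<Rightarrow>\<^sub>0 complex) \<Rightarrow> ((complex \<times> int) \<times> (complex \<times> int) \<Rightarrow>\<^sub>0 complex)" where
  "loop_operator t a x = (\<Sum>\<epsilon>\<in>signs. Poly_Mapping.single (loop a \<epsilon>)
     (\<Sum>\<eta>\<in>signs. t a \<epsilon> \<eta> * Poly_Mapping.lookup x (loop a \<eta>)))"

lemma loop_eq_iff [simp]: "loop a \<epsilon> = loop a' \<eta> \<longleftrightarrow> a = a' \<and> \<epsilon> = \<eta>"
  by (auto simp: loop_def)

lemma lookup_loop_operator:
  assumes "\<epsilon> \<in> signs"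
  shows "Poly_Mapping.lookup (loop_operator t a x) (loop a \<epsilon>) =
    (\<Sum>\<eta>\<in>signs. t a \<epsilon> \<eta> * Poly_Mapping.lookup x (loop a \<eta>))"
  using assms by (auto simp: loop_operator_def lookup_add lookup_single when_def)

lemma lookup_loop_operator_off:
  assumes "y \<notin> loop a ` signs"
  shows "Poly_Mapping.lookup (loop_operator t a x) y = 0"
  using assms by (auto simp: loop_operator_def lookup_add lookup_single when_def)

text \<open>A matrix satisfying the rank condition behaves like a multiple of a projection: its square is its
  trace times itself.\<close>

lemma loop_operator_square:
  assumes rank: "\<And>\<epsilon> \<zeta> \<eta>. \<lbrakk>\<epsilon> \<in> signs; \<zeta> \<in> signs; \<eta> \<in> signs\<rbrakk> \<Longrightarrow>
      t a \<epsilon> \<zeta> * t a \<zeta> \<eta> = t a \<zeta> \<zeta> * t a \<epsilon> \<eta>"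
    and trace: "(\<Sum>\<epsilon>\<in>signs. t a \<epsilon> \<epsilon>) = k"
  shows "loop_operator t a (loop_operator t a x) = scale k (loop_operator t a x)"
proof (rule poly_mapping_eqI)
  fix y
  show "Poly_Mapping.lookup (loop_operator t a (loop_operator t a x)) y =
      Poly_Mapping.lookup (scale k (loop_operator t a x)) y"
  proof (cases "y \<in> loop a ` signs")
    case False
    then show ?thesis by (simp add: lookup_loop_operator_off lookup_scale)
  next
    case True
    then obtain \<epsilon> where \<epsilon>: "\<epsilon> \<in> signs" and y: "y = loop a \<epsilon>" by blast
    have "Poly_Mapping.lookup (loop_operator t a (loop_operator t a x)) y =
        (\<Sum>\<zeta>\<in>signs. \<Sum>\<eta>\<in>signs. t a \<epsilon> \<zeta> * t a \<zeta> \<eta> * Poly_Mapping.lookup x (loop a \<eta>))"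
      using \<epsilon> unfolding y
      by (simp only: lookup_loop_operator sum_distrib_left mult.assoc cong: sum.cong)
    also have "\<dots> = (\<Sum>\<zeta>\<in>signs. \<Sum>\<eta>\<in>signs. t a \<zeta> \<zeta> * t a \<epsilon> \<eta> * Poly_Mapping.lookup x (loop a \<eta>))"
      by (intro sum.cong refl) (simp only: rank[OF \<epsilon>])
    also have "\<dots> = k * (\<Sum>\<eta>\<in>signs. t a \<epsilon> \<eta> * Poly_Mapping.lookup x (loop a \<eta>))"
      unfolding trace[symmetric] sum_product by (simp only: mult.assoc)
    finally show ?thesis using \<epsilon> by (simp only: y lookup_scale lookup_loop_operator)
  qed
qed

section \<open>Action on paths of length three\<close>

text \<open>The sum over the support of \<open>x\<close> in the definition of the action collapses to the at most two paths
  whose first two steps form a loop at \<open>a\<close> and whose last step is \<open>s\<close>. This coordinate form holds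
  for every \<open>x\<close>, so products of actions can be computed without tracking supports.\<close>

lemma lookup_act12_loop_operator:
  assumes "\<epsilon> \<in> signs" and "loop a \<epsilon> = (p, q)"
  shows "Poly_Mapping.lookup (act12 (loop_operator t) a x) (p, q, s) =
    (\<Sum>\<eta>\<in>signs. t a \<epsilon> \<eta> * Poly_Mapping.lookup x ((a, \<eta>), (a + of_int \<eta>, - \<eta>), s))"
proof -
  let ?l = "Poly_Mapping.lookup" and ?k = "Poly_Mapping.keys"
  have "?l (act12 (loop_operator t) a x) (p, q, s) = (\<Sum>y\<in>?k x. \<Sum>\<eta>\<in>signs.
      if y = ((a, \<eta>), (a + of_int \<eta>, - \<eta>), s) then t a \<epsilon> \<eta> * ?l x y else 0)"
    unfolding act12_def lookup_sum
  proof (intro sum.cong refl)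
    fix y assume "y \<in> ?k x"
    obtain i j k where y: "y = (i, j, k)" by (metis prod_cases3)
    show "?l (case y of (i, j, k) \<Rightarrow> scale (?l x (i, j, k)) (reassoc (tensor_vec
        (loop_operator t a (tensor_vec (basis_vec i) (basis_vec j))) (basis_vec k)))) (p, q, s) =
      (\<Sum>\<eta>\<in>signs. if y = ((a, \<eta>), (a + of_int \<eta>, - \<eta>), s) then t a \<epsilon> \<eta> * ?l x y else 0)"
      unfolding y prod.case lookup_scale lookup_reassoc lookup_tensor_vec assms(2)[symmetric]
        lookup_loop_operator[OF assms(1)] tensor_basis_vec lookup_basis_vec
      by (auto simp: loop_def)
  qed
  also have "\<dots> = (\<Sum>\<eta>\<in>signs. \<Sum>y\<in>?k x.
      if y = ((a, \<eta>), (a + of_int \<eta>, - \<eta>), s) then t a \<epsilon> \<eta> * ?l x y else 0)"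
    by (rule sum.swap)
  also have "\<dots> = (\<Sum>\<eta>\<in>signs. t a \<epsilon> \<eta> * ?l x ((a, \<eta>), (a + of_int \<eta>, - \<eta>), s))"
    by (intro sum.cong refl) (simp add: sum.delta in_keys_iff)
  finally show ?thesis .
qed

lemma lookup_act12_loop_operator_off:
  assumes "(p, q) \<notin> loop a ` signs"
  shows "Poly_Mapping.lookup (act12 (loop_operator t) a x) (p, q, s) = 0"
  unfolding act12_def lookup_sum
  by (rule sum.neutral)
     (simp add: split_paired_all lookup_scale lookup_reassoc lookup_tensor_vec
       lookup_loop_operator_off[OF assms])

text \<open>The vertex \<open>m\<close> where the loop is based is read off from the first step \<open>p\<close>, which the action
  preserves; so for a fixed \<open>p\<close> the matrix involved is fixed.\<close>

lemma lookup_act23_loop_operator: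
  assumes "\<epsilon> \<in> signs" and "tgt G (deg V p) = m" and "loop m \<epsilon> = q"
  shows "Poly_Mapping.lookup (act23 G V (loop_operator t) x) (p, q) =
    (\<Sum>\<eta>\<in>signs. t m \<epsilon> \<eta> * Poly_Mapping.lookup x (p, loop m \<eta>))"
proof -
  let ?l = "Poly_Mapping.lookup" and ?k = "Poly_Mapping.keys"
  have "?l (act23 G V (loop_operator t) x) (p, q) = (\<Sum>y\<in>?k x. \<Sum>\<eta>\<in>signs.
      if y = (p, loop m \<eta>) then t m \<epsilon> \<eta> * ?l x y else 0)"
    unfolding act23_def lookup_sum
  proof (intro sum.cong refl)
    fix y assume "y \<in> ?k x"
    obtain i j k where y: "y = (i, j, k)" by (metis prod_cases3)
    show "?l (case y of (i, j, k) \<Rightarrow> scale (?l x (i, j, k)) (tensor_vec (basis_vec i)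
        (loop_operator t (tgt G (deg V i)) (tensor_vec (basis_vec j) (basis_vec k))))) (p, q) =
      (\<Sum>\<eta>\<in>signs. if y = (p, loop m \<eta>) then t m \<epsilon> \<eta> * ?l x y else 0)"
    proof (cases "i = p")
      case True
      have e: "tgt G (deg V i) = m" using True assms(2) by simp
      show ?thesis
        unfolding y prod.case lookup_scale lookup_tensor_vec assms(3)[symmetric] e
          lookup_loop_operator[OF assms(1)] tensor_basis_vec lookup_basis_vec
        using True by (auto simp: loop_def)
    next
      case False
      then show ?thesis by (simp add: y lookup_scale lookup_tensor_vec lookup_basis_vec)
    qed
  qed
  also have "\<dots> = (\<Sum>\<eta>\<in>signs. \<Sum>y\<in>?k x.
      if y = (p, loop m \<eta>) then t m \<epsilon> \<eta> * ?l x y else 0)"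
    by (rule sum.swap)
  also have "\<dots> = (\<Sum>\<eta>\<in>signs. t m \<epsilon> \<eta> * ?l x (p, loop m \<eta>))"
    by (intro sum.cong refl) (simp add: sum.delta in_keys_iff)
  finally show ?thesis .
qed

lemma lookup_act23_loop_operator_off:
  assumes "q \<notin> loop (tgt G (deg V p)) ` signs"
  shows "Poly_Mapping.lookup (act23 G V (loop_operator t) x) (p, q) = 0"
  unfolding act23_def lookup_sum
proof (rule sum.neutral, rule ballI)
  fix y :: "(complex \<times> int) \<times> (complex \<times> int) \<times> (complex \<times> int)"
  obtain i j k where y: "y = (i, j, k)" by (metis prod_cases3)
  show "Poly_Mapping.lookup (case y of (i, j, k) \<Rightarrow> scale (Poly_Mapping.lookup x (i, j, k))
      (tensor_vec (basis_vec i) (loop_operator t (tgt G (deg V i))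
        (tensor_vec (basis_vec j) (basis_vec k))))) (p, q) = 0"
    using assms by (cases "i = p")
      (simp_all add: y lookup_scale lookup_tensor_vec lookup_basis_vec lookup_loop_operator_off)
qed

section \<open>Degrees and paths in the unrestricted groupoid\<close>

lemma shifted_ints_step:
  assumes "a \<in> shifted_ints b"
  shows "a + of_int n \<in> shifted_ints b"
proof -
  from assms obtain m where "a = of_int m + b" by (auto simp: shifted_ints_def)
  then have "a + of_int n = of_int (m + n) + b" by simp
  then show ?thesis unfolding shifted_ints_def by blast
qed

lemma step_walk:
  assumes "a \<in> shifted_ints b" and "\<epsilon> \<in> signs"
  shows "[a, a + of_int \<epsilon>] \<in> walks (shifted_ints b) (neighbour_edges b)"
proof -
  have "{a, a + of_int \<epsilon>} \<in> neighbour_edges b"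
  proof (cases "\<epsilon> = 1")
    case True
    then show ?thesis using assms(1) by (auto simp: neighbour_edges_def)
  next
    case False
    then have "{a, a + of_int \<epsilon>} = {a + of_int \<epsilon>, (a + of_int \<epsilon>) + 1}" using assms(2) by auto
    then show ?thesis unfolding neighbour_edges_def using shifted_ints_step[OF assms(1), of \<epsilon>] by blast
  qed
  then show ?thesis using assms shifted_ints_step[OF assms(1), of \<epsilon>] by (simp add: walks_def)
qed

lemma basis_V_A_unres: "(a, \<epsilon>) \<in> basis (V_A_unres b) \<longleftrightarrow> a \<in> shifted_ints b \<and> \<epsilon> \<in> signs"
  by (auto simp: V_A_unres_def)

lemma deg_V_A_unres:
  assumes "a \<in> shifted_ints b" and "\<epsilon> \<in> signs"
  shows "deg (V_A_unres b) (a, \<epsilon>) \<in> Arr (pi_A_unres b)"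
    and "src (pi_A_unres b) (deg (V_A_unres b) (a, \<epsilon>)) = a"
    and "tgt (pi_A_unres b) (deg (V_A_unres b) (a, \<epsilon>)) = a + of_int \<epsilon>"
  using step_walk[OF assms]
  by (auto simp: V_A_unres_def pi_A_unres_def graph_groupoid_src graph_groupoid_tgt)
     (auto simp: graph_groupoid_def)

lemma loop_in_basis:
  assumes "a \<in> shifted_ints b" and "\<epsilon> \<in> signs"
  shows "loop a \<epsilon> \<in> basis (tensor (pi_A_unres b) (V_A_unres b) (V_A_unres b))"
  using assms shifted_ints_step[OF assms(1), of \<epsilon>]
    deg_V_A_unres[OF assms] deg_V_A_unres[of "a + of_int \<epsilon>" b "-\<epsilon>"]
  by (auto simp: loop_def tensor_def basis_V_A_unres)

text \<open>The backtracking relation of the groupoid identifies the walk \<open>a, a + \<epsilon>, a\<close> with the trivial one.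
  Hence both loops at \<open>a\<close> lie in one component, and mixing them respects the grading.\<close>

lemma deg_loop:
  assumes a: "a \<in> shifted_ints b" and \<epsilon>: "\<epsilon> \<in> signs"
  shows "deg (tensor (pi_A_unres b) (V_A_unres b) (V_A_unres b)) (loop a \<epsilon>) = idn (pi_A_unres b) a"
proof -
  let ?U = "shifted_ints b" and ?E = "neighbour_edges b"
  let ?c = "a + of_int \<epsilon>"
  have c: "?c \<in> ?U" by (rule shifted_ints_step[OF a])
  have w1: "[a, ?c] \<in> walks ?U ?E" by (rule step_walk[OF a \<epsilon>])
  have w2: "[?c, a] \<in> walks ?U ?E" using step_walk[OF c, of "-\<epsilon>"] \<epsilon> by auto
  have w: "[a, ?c, a] \<in> walks ?U ?E" using walk_append[OF w1 w2] by simp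
  have "[a] \<in> walks ?U ?E" using a by (simp add: walks_def)
  then have "([a, ?c, a], [a]) \<in> cancel ?U ?E"
    unfolding cancel_def using w by (auto intro!: exI[of _ "[]"])
  then have "walk_arrow ?U ?E [a, ?c, a] = walk_arrow ?U ?E [a]"
    by (simp add: walk_arrow_eq_iff homotopic_step)
  moreover have "deg (tensor (pi_A_unres b) (V_A_unres b) (V_A_unres b)) (loop a \<epsilon>)
      = walk_arrow ?U ?E [a, ?c, a]"
    using graph_groupoid_cmp[OF w1 w2]
    by (simp add: tensor_def loop_def V_A_unres_def pi_A_unres_def)
  ultimately show ?thesis by (simp add: pi_A_unres_def graph_groupoid_def)
qed

lemma linear_loop_operator:
  "loop_operator t a (x + y) = loop_operator t a x + loop_operator t a y"
  "loop_operator t a (scale c x) = scale c (loop_operator t a x)"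
proof -
  have "Poly_Mapping.lookup (loop_operator t a (x + y)) z =
      Poly_Mapping.lookup (loop_operator t a x + loop_operator t a y) z \<and>
    Poly_Mapping.lookup (loop_operator t a (scale c x)) z =
      Poly_Mapping.lookup (scale c (loop_operator t a x)) z" for z
  proof (cases "z \<in> loop a ` signs")
    case False
    then show ?thesis by (simp add: lookup_loop_operator_off lookup_add lookup_scale)
  next
    case True
    then obtain \<epsilon> where "\<epsilon> \<in> signs" and z: "z = loop a \<epsilon>" by blast
    then show ?thesis
      unfolding z lookup_add lookup_scale lookup_loop_operator[OF \<open>\<epsilon> \<in> signs\<close>]
      by (simp add: algebra_simps)
  qed
  then show "loop_operator t a (x + y) = loop_operator t a x + loop_operator t a y"
    and "loop_operator t a (scale c x) = scale c (loop_operator t a x)"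
    by (auto intro: poly_mapping_eqI)
qed

lemma loop_operator_fiber_End:
  assumes a: "a \<in> shifted_ints b"
  shows "loop_operator t a \<in> fiber_End (pi_A_unres b) (tensor (pi_A_unres b) (V_A_unres b) (V_A_unres b)) a"
proof -
  let ?G = "pi_A_unres b"
  let ?W = "tensor ?G (V_A_unres b) (V_A_unres b)"
  have zero: "loop_operator t a x = 0" if x: "x \<in> component ?W \<alpha>" and \<alpha>: "\<alpha> \<noteq> idn ?G a" for x \<alpha>
  proof -
    have "Poly_Mapping.lookup x (loop a \<epsilon>) = 0" if "\<epsilon> \<in> signs" for \<epsilon>
      using x \<alpha> deg_loop[OF a that] by (auto simp: component_def in_keys_iff)
    then show ?thesis by (simp add: loop_operator_def)
  qed
  have "Poly_Mapping.keys (loop_operator t a x) \<subseteq> loop a ` signs" for x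
    using lookup_loop_operator_off by (fastforce simp only: in_keys_iff)
  then have range: "loop_operator t a x \<in> component ?W (idn ?G a)" for x
    using deg_loop[OF a] loop_in_basis[OF a] unfolding component_def by blast
  have "loop_operator t a ` component ?W \<alpha> \<subseteq> component ?W \<alpha>" for \<alpha>
  proof (cases "\<alpha> = idn ?G a")
    case True
    then show ?thesis using range by blast
  next
    case False
    have "0 \<in> component ?W \<alpha>" by (simp add: component_def)
    then show ?thesis using zero[OF _ False] by auto
  qed
  moreover have "finite {\<alpha> \<in> Arr ?G. src ?G \<alpha> = a \<and> (\<exists>x\<in>component ?W \<alpha>. loop_operator t a x \<noteq> 0)}"
    by (rule finite_subset[of _ "{idn ?G a}"]) (use zero in auto)
  ultimately show ?thesis
    by (simp add: fiber_End_def linear_on_sub_def linear_loop_operator)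
qed

text \<open>The cubic relations fail on triples of steps that are not composable. For example \<open>T\<^sup>(\<^sup>2\<^sup>3\<^sup>)T\<^sup>(\<^sup>1\<^sup>2\<^sup>)\<close> vanishes on a loop at \<open>a\<close> followed by a step from another
  vertex, while \<open>T\<^sup>(\<^sup>1\<^sup>2\<^sup>)\<close> need not. This description of the source fiber excludes such triples.\<close>

lemma source_fiber_triple_paths:
  assumes a: "a \<in> Ob (pi_A_unres b)"
    and x: "x \<in> source_fiber (pi_A_unres b)
      (tensor (pi_A_unres b) (V_A_unres b) (tensor (pi_A_unres b) (V_A_unres b) (V_A_unres b))) a"
    and nz: "Poly_Mapping.lookup x (i, j, k) \<noteq> 0"
  obtains \<epsilon>\<^sub>1 \<epsilon>\<^sub>2 \<epsilon>\<^sub>3 where "\<epsilon>\<^sub>1 \<in> signs" "\<epsilon>\<^sub>2 \<in> signs" "\<epsilon>\<^sub>3 \<in> signs"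
    "i = (a, \<epsilon>\<^sub>1)" "j = (a + of_int \<epsilon>\<^sub>1, \<epsilon>\<^sub>2)" "k = (a + of_int \<epsilon>\<^sub>1 + of_int \<epsilon>\<^sub>2, \<epsilon>\<^sub>3)"
proof -
  let ?G = "pi_A_unres b" and ?V = "V_A_unres b"
  obtain c\<^sub>1 \<epsilon>\<^sub>1 c\<^sub>2 \<epsilon>\<^sub>2 c\<^sub>3 \<epsilon>\<^sub>3 where ijk: "i = (c\<^sub>1, \<epsilon>\<^sub>1)" "j = (c\<^sub>2, \<epsilon>\<^sub>2)" "k = (c\<^sub>3, \<epsilon>\<^sub>3)" by fastforce
  have key: "(i, j, k) \<in> Poly_Mapping.keys x" using nz by (simp add: in_keys_iff)
  have mem: "(i, j, k) \<in> basis (tensor ?G ?V (tensor ?G ?V ?V))"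
    and src: "src ?G (deg (tensor ?G ?V (tensor ?G ?V ?V)) (i, j, k)) = a"
    using x key unfolding source_fiber_def by blast+
  have c: "c\<^sub>1 \<in> shifted_ints b" "\<epsilon>\<^sub>1 \<in> signs" "c\<^sub>2 \<in> shifted_ints b" "\<epsilon>\<^sub>2 \<in> signs"
    "c\<^sub>3 \<in> shifted_ints b" "\<epsilon>\<^sub>3 \<in> signs"
    using mem by (auto simp: tensor_def ijk basis_V_A_unres)
  note d1 = deg_V_A_unres[OF c(1,2)] and d2 = deg_V_A_unres[OF c(3,4)] and d3 = deg_V_A_unres[OF c(5,6)]
  have t23: "tgt ?G (deg ?V j) = src ?G (deg ?V k)"
    and t123: "tgt ?G (deg ?V i) = src ?G (cmp ?G (deg ?V k) (deg ?V j))"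
    using mem by (auto simp: tensor_def)
  have k23: "cmp ?G (deg ?V k) (deg ?V j) \<in> Arr ?G"
      "src ?G (cmp ?G (deg ?V k) (deg ?V j)) = c\<^sub>2"
    using groupoid.cmp_in[OF groupoid_pi_A_unres _ _ t23] d2 d3 by (auto simp: ijk)
  have "src ?G (deg (tensor ?G ?V (tensor ?G ?V ?V)) (i, j, k)) = c\<^sub>1"
    using groupoid.cmp_in[OF groupoid_pi_A_unres _ k23(1) t123] d1 by (auto simp: ijk tensor_def)
  then have "c\<^sub>1 = a" using src by simp
  moreover have "c\<^sub>2 = c\<^sub>1 + of_int \<epsilon>\<^sub>1" using t123 k23 d1 by (simp add: ijk)
  moreover have "c\<^sub>3 = c\<^sub>2 + of_int \<epsilon>\<^sub>2" using t23 d2 d3 by (simp add: ijk)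
  ultimately show ?thesis using that c ijk by blast
qed


section \<open>The Temperley--Lieb relations\<close>

text \<open>The last step \<open>s\<close> survives \<open>T\<^sup>(\<^sup>1\<^sup>2\<^sup>)\<close>. For the outer factors to be linked by \<open>T\<^sup>(\<^sup>2\<^sup>3\<^sup>)\<close>, the loop
  \<open>a \<rightarrow> a + \<eta> \<rightarrow> a\<close> between them must begin with the same step as \<open>s\<close>; this singles out one value of
  \<open>\<eta>\<close>.\<close>

lemma act12_act23_act12:
  assumes a: "a \<in> shifted_ints b"
    and rank: "\<And>\<epsilon> \<zeta> \<eta>. \<lbrakk>\<epsilon> \<in> signs; \<zeta> \<in> signs; \<eta> \<in> signs\<rbrakk> \<Longrightarrow>
      t a \<epsilon> \<zeta> * t a \<zeta> \<eta> = t a \<zeta> \<zeta> * t a \<epsilon> \<eta>"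
    and dual: "\<And>\<epsilon>. \<epsilon> \<in> signs \<Longrightarrow> t a \<epsilon> \<epsilon> * t (a + of_int \<epsilon>) (- \<epsilon>) (- \<epsilon>) = 1"
    and x: "x \<in> source_fiber (pi_A_unres b)
      (tensor (pi_A_unres b) (V_A_unres b) (tensor (pi_A_unres b) (V_A_unres b) (V_A_unres b))) a"
  shows "act12 (loop_operator t) a (act23 (pi_A_unres b) (V_A_unres b) (loop_operator t)
      (act12 (loop_operator t) a x)) = act12 (loop_operator t) a x"
proof (rule poly_mapping_eqI)
  let ?l = "Poly_Mapping.lookup" and ?T12 = "act12 (loop_operator t) a"
    and ?T23 = "act23 (pi_A_unres b) (V_A_unres b) (loop_operator t)"
  let ?path = "\<lambda>\<eta> s. ((a, \<eta>), (a + of_int \<eta>, - \<eta>), s)"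
  have obj: "a \<in> Ob (pi_A_unres b)" using a by (simp add: pi_A_unres_def graph_groupoid_def)
  have tgt: "tgt (pi_A_unres b) (deg (V_A_unres b) (a, \<eta>)) = a + of_int \<eta>" if "\<eta> \<in> signs" for \<eta>
    by (rule deg_V_A_unres(3)[OF a that])
  fix y :: "(complex \<times> int) \<times> (complex \<times> int) \<times> (complex \<times> int)"
  obtain p q s where y: "y = (p, q, s)" by (metis prod_cases3)
  show "?l (?T12 (?T23 (?T12 x))) y = ?l (?T12 x) y"
  proof (cases "(p, q) \<in> loop a ` signs")
    case False
    then show ?thesis by (simp add: y lookup_act12_loop_operator_off)
  next
    case True
    then obtain \<epsilon> where \<epsilon>: "\<epsilon> \<in> signs" and pq: "loop a \<epsilon> = (p, q)" by auto
    \<comment> \<open>\<open>T\<^sup>(\<^sup>2\<^sup>3\<^sup>)\<close> could also use the other loop at \<open>a + \<eta>\<close>, coming from the steps \<open>(\<eta>, \<eta>, -\<eta>)\<close>; but such a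
      path is not in the range of \<open>T\<^sup>(\<^sup>1\<^sup>2\<^sup>)\<close>.\<close>
    have mid: "?l (?T23 (?T12 x)) (?path \<eta> s) =
        (if s = (a, \<eta>) then t (a + of_int \<eta>) (- \<eta>) (- \<eta>) * ?l (?T12 x) (?path \<eta> s) else 0)"
      if \<eta>: "\<eta> \<in> signs" for \<eta>
    proof (cases "s = (a, \<eta>)")
      case False
      have "((a + of_int \<eta>, - \<eta>), s) \<notin> loop (tgt (pi_A_unres b) (deg (V_A_unres b) (a, \<eta>))) ` signs"
        using False unfolding tgt[OF \<eta>] by (auto simp: loop_def)
      then show ?thesis using False by (simp add: lookup_act23_loop_operator_off)
    next
      case s: True
      have m: "- \<eta> \<in> signs" using \<eta> by auto
      have "?l (?T12 x) ((a, \<eta>), loop (a + of_int \<eta>) \<eta>) = 0"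
        unfolding loop_def by (rule lookup_act12_loop_operator_off) (use \<eta> in \<open>auto simp: loop_def\<close>)
      moreover have "loop (a + of_int \<eta>) (- \<eta>) = ((a + of_int \<eta>, - \<eta>), s)"
        by (simp add: loop_def s)
      moreover have "(\<Sum>\<zeta>\<in>signs. f \<zeta>) = f (- \<eta>) + f \<eta>" for f :: "int \<Rightarrow> complex"
        using \<eta> by auto
      ultimately show ?thesis
        by (simp only: lookup_act23_loop_operator[OF m tgt[OF \<eta>]]) (simp add: s)
    qed
    have expand: "?l (?T12 (?T23 (?T12 x))) y = (\<Sum>\<eta>\<in>signs. t a \<epsilon> \<eta> *
        (if s = (a, \<eta>) then t (a + of_int \<eta>) (- \<eta>) (- \<eta>) * ?l (?T12 x) (?path \<eta> s) else 0))"
      unfolding y lookup_act12_loop_operator[OF \<epsilon> pq] by (intro sum.cong refl) (simp only: mid)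
    show ?thesis
    proof (cases "s \<in> Pair a ` signs")
      case False
      have "?l x (?path \<eta> s) = 0" if "\<eta> \<in> signs" for \<eta>
      proof (rule ccontr)
        assume "?l x (?path \<eta> s) \<noteq> 0"
        then show False by (rule source_fiber_triple_paths[OF obj x]) (use False in auto)
      qed
      then have "?l (?T12 x) y = 0" unfolding y lookup_act12_loop_operator[OF \<epsilon> pq] by simp
      moreover have "?l (?T12 (?T23 (?T12 x))) y = 0"
        unfolding expand using False by auto
      ultimately show ?thesis by simp
    next
      case True
      then obtain \<eta> where \<eta>: "\<eta> \<in> signs" and s: "s = (a, \<eta>)" by auto
      have loop: "loop a \<eta> = ((a, \<eta>), (a + of_int \<eta>, - \<eta>))" by (simp add: loop_def)
      have "?l (?T12 (?T23 (?T12 x))) y =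
          t a \<epsilon> \<eta> * (t (a + of_int \<eta>) (- \<eta>) (- \<eta>) * ?l (?T12 x) (?path \<eta> s))"
        unfolding expand using \<eta> by (auto simp: s)
      also have "\<dots> = (\<Sum>\<xi>\<in>signs. t (a + of_int \<eta>) (- \<eta>) (- \<eta>) *
          (t a \<epsilon> \<eta> * t a \<eta> \<xi>) * ?l x (?path \<xi> s))"
        unfolding lookup_act12_loop_operator[OF \<eta> loop] by (simp add: algebra_simps)
      also have "\<dots> = (\<Sum>\<xi>\<in>signs. (t a \<eta> \<eta> * t (a + of_int \<eta>) (- \<eta>) (- \<eta>)) *
          (t a \<epsilon> \<xi> * ?l x (?path \<xi> s)))"
        by (intro sum.cong refl) (simp only: rank[OF \<epsilon> \<eta>] mult_ac)
      also have "\<dots> = ?l (?T12 x) y"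
        unfolding dual[OF \<eta>] y lookup_act12_loop_operator[OF \<epsilon> pq] by simp
      finally show ?thesis .
    qed
  qed
qed

text \<open>Here the first step \<open>(a, \<epsilon>)\<close> survives \<open>T\<^sup>(\<^sup>2\<^sup>3\<^sup>)\<close>. The inner \<open>T\<^sup>(\<^sup>1\<^sup>2\<^sup>)\<close> must take loops at \<open>a\<close> to loops
  at \<open>a\<close>, and both begin with \<open>\<epsilon>\<close> for the two outer factors to act; so it contributes only its diagonal
  entry \<open>t\<^sub>a(\<epsilon>, \<epsilon>)\<close>. The rank condition is needed at \<open>a + \<epsilon>\<close>.\<close>

lemma act23_act12_act23:
  assumes a: "a \<in> shifted_ints b"
    and rank: "\<And>c \<epsilon> \<zeta> \<eta>. \<lbrakk>c \<in> shifted_ints b; \<epsilon> \<in> signs; \<zeta> \<in> signs; \<eta> \<in> signs\<rbrakk> \<Longrightarrow>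
      t c \<epsilon> \<zeta> * t c \<zeta> \<eta> = t c \<zeta> \<zeta> * t c \<epsilon> \<eta>"
    and dual: "\<And>\<epsilon>. \<epsilon> \<in> signs \<Longrightarrow> t a \<epsilon> \<epsilon> * t (a + of_int \<epsilon>) (- \<epsilon>) (- \<epsilon>) = 1"
    and x: "x \<in> source_fiber (pi_A_unres b)
      (tensor (pi_A_unres b) (V_A_unres b) (tensor (pi_A_unres b) (V_A_unres b) (V_A_unres b))) a"
  shows "act23 (pi_A_unres b) (V_A_unres b) (loop_operator t) (act12 (loop_operator t) a
      (act23 (pi_A_unres b) (V_A_unres b) (loop_operator t) x)) =
    act23 (pi_A_unres b) (V_A_unres b) (loop_operator t) x"
proof (rule poly_mapping_eqI)
  let ?l = "Poly_Mapping.lookup" and ?T12 = "act12 (loop_operator t) a"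
    and ?T23 = "act23 (pi_A_unres b) (V_A_unres b) (loop_operator t)"
  have obj: "a \<in> Ob (pi_A_unres b)" using a by (simp add: pi_A_unres_def graph_groupoid_def)
  fix y :: "(complex \<times> int) \<times> (complex \<times> int) \<times> (complex \<times> int)"
  obtain p q where y: "y = (p, q)" by (cases y)
  define m where "m = tgt (pi_A_unres b) (deg (V_A_unres b) p)"
  show "?l (?T23 (?T12 (?T23 x))) y = ?l (?T23 x) y"
  proof (cases "q \<in> loop m ` signs")
    case False
    then show ?thesis by (simp add: y m_def lookup_act23_loop_operator_off)
  next
    case True
    then obtain \<delta> where \<delta>: "\<delta> \<in> signs" and q: "loop m \<delta> = q" by auto
    note out = lookup_act23_loop_operator[OF \<delta> m_def[symmetric] q]
    show ?thesis
    proof (cases "p \<in> Pair a ` signs")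
      case False
      have "?l x (p, loop m \<eta>) = 0" for \<eta>
      proof (rule ccontr)
        assume "?l x (p, loop m \<eta>) \<noteq> 0"
        then show False unfolding loop_def
          by (rule source_fiber_triple_paths[OF obj x]) (use False in auto)
      qed
      moreover have "?l (?T12 (?T23 x)) (p, loop m \<eta>) = 0" for \<eta>
        unfolding loop_def by (rule lookup_act12_loop_operator_off) (use False in \<open>auto simp: loop_def\<close>)
      ultimately show ?thesis unfolding y out by simp
    next
      case True
      then obtain \<epsilon> where \<epsilon>: "\<epsilon> \<in> signs" and p: "p = (a, \<epsilon>)" by auto
      have m: "m = a + of_int \<epsilon>" unfolding m_def p by (rule deg_V_A_unres(3)[OF a \<epsilon>])
      have mU: "m \<in> shifted_ints b" unfolding m by (rule shifted_ints_step[OF a])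
      have n\<epsilon>: "- \<epsilon> \<in> signs" using \<epsilon> by auto
      have two: "(\<Sum>\<zeta>\<in>signs. f \<zeta>) = f \<epsilon> + f (- \<epsilon>)" for f :: "int \<Rightarrow> complex"
        using \<epsilon> by auto
      \<comment> \<open>The one path on which all three factors can act: forth, back and forth along one edge.\<close>
      have turn: "(p, loop m (- \<epsilon>)) = ((a, \<epsilon>), (a + of_int \<epsilon>, - \<epsilon>), (a, \<epsilon>))"
        by (simp add: p m loop_def)
      have "?l (?T12 (?T23 x)) (p, loop m \<epsilon>) = 0"
        unfolding loop_def by (rule lookup_act12_loop_operator_off) (use \<epsilon> in \<open>auto simp: loop_def p m\<close>)
      then have outer: "?l (?T23 (?T12 (?T23 x))) y =
          t m \<delta> (- \<epsilon>) * ?l (?T12 (?T23 x)) (p, loop m (- \<epsilon>))"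
        unfolding y out two by simp
      have loop: "loop a \<epsilon> = ((a, \<epsilon>), (a + of_int \<epsilon>, - \<epsilon>))" by (simp add: loop_def)
      \<comment> \<open>The other loop at \<open>a\<close> starts towards \<open>a - \<epsilon>\<close>, and the step \<open>(a, \<epsilon>)\<close> then does not lead back
        to \<open>a - \<epsilon>\<close>, so this path is not in the range of \<open>T\<^sup>(\<^sup>2\<^sup>3\<^sup>)\<close>.\<close>
      have "?l (?T23 x) ((a, - \<epsilon>), (a - of_int \<epsilon>, \<epsilon>), (a, \<epsilon>)) = 0"
        by (rule lookup_act23_loop_operator_off)
          (use \<epsilon> deg_V_A_unres(3)[OF a n\<epsilon>] in \<open>auto simp: loop_def\<close>)
      then have middle: "?l (?T12 (?T23 x)) (p, loop m (- \<epsilon>)) = t a \<epsilon> \<epsilon> * ?l (?T23 x) (p, loop m (- \<epsilon>))"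
        unfolding turn lookup_act12_loop_operator[OF \<epsilon> loop] two by simp
      have inner: "?l (?T23 x) (p, loop m (- \<epsilon>)) = (\<Sum>\<eta>\<in>signs. t m (- \<epsilon>) \<eta> * ?l x (p, loop m \<eta>))"
        by (rule lookup_act23_loop_operator[OF n\<epsilon> m_def[symmetric] refl])
      have "?l (?T23 (?T12 (?T23 x))) y =
          (\<Sum>\<eta>\<in>signs. t a \<epsilon> \<epsilon> * (t m \<delta> (- \<epsilon>) * t m (- \<epsilon>) \<eta>) * ?l x (p, loop m \<eta>))"
        unfolding outer middle inner by (simp add: algebra_simps)
      also have "\<dots> = (\<Sum>\<eta>\<in>signs. (t a \<epsilon> \<epsilon> * t m (- \<epsilon>) (- \<epsilon>)) * (t m \<delta> \<eta> * ?l x (p, loop m \<eta>)))"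
        by (intro sum.cong refl) (simp only: rank[OF mU \<delta> n\<epsilon>] mult_ac)
      also have "\<dots> = ?l (?T23 x) y"
        unfolding y out m dual[OF \<epsilon>] by simp
      finally show ?thesis .
    qed
  qed
qed

theorem local_dynamical_TL_loop_operator:
  assumes nz: "\<And>a. a \<in> shifted_ints b \<Longrightarrow> \<kappa> a \<noteq> 0"
    and rank: "\<And>a \<epsilon> \<zeta> \<eta>. \<lbrakk>a \<in> shifted_ints b; \<epsilon> \<in> signs; \<zeta> \<in> signs; \<eta> \<in> signs\<rbrakk> \<Longrightarrow>
      t a \<epsilon> \<zeta> * t a \<zeta> \<eta> = t a \<zeta> \<zeta> * t a \<epsilon> \<eta>"
    and trace: "\<And>a. a \<in> shifted_ints b \<Longrightarrow> (\<Sum>\<epsilon>\<in>signs. t a \<epsilon> \<epsilon>) = \<kappa> a"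
    and dual: "\<And>a \<epsilon>. \<lbrakk>a \<in> shifted_ints b; \<epsilon> \<in> signs\<rbrakk> \<Longrightarrow>
      t a \<epsilon> \<epsilon> * t (a + of_int \<epsilon>) (- \<epsilon>) (- \<epsilon>) = 1"
  shows "local_dynamical_TL (pi_A_unres b) (V_A_unres b) \<kappa> (loop_operator t)"
proof -
  have ob: "Ob (pi_A_unres b) = shifted_ints b" by (simp add: pi_A_unres_def graph_groupoid_def)
  show ?thesis
    unfolding local_dynamical_TL_def ob
    by (intro conjI ballI nz loop_operator_fiber_End loop_operator_square
        act12_act23_act12[where b = b] act23_act12_act23[where b = b] rank trace dual)
qed

section \<open>The trigonometric operator\<close>

definition tri_coeff :: "nat \<Rightarrow> (complex \<Rightarrow> complex) \<Rightarrow> complex \<Rightarrow> int \<Rightarrow> int \<Rightarrow> complex" where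
  "tri_coeff L r a \<epsilon> \<eta> = (if \<epsilon> = \<eta> then bracket L (a + of_int \<epsilon>) else r a) / bracket L a"

lemma T_tri_eq_loop_operator: "T_tri L r = loop_operator (tri_coeff L r)"
proof (intro ext)
  fix a x
  have U: "(UNIV :: (2 \<times> 2) set) = {(1, 1), (1, 2), (2, 1), (2, 2)}"
    by (auto simp: UNIV_2 simp flip: UNIV_Times_UNIV)
  have e: "eps 1 = 1" "eps 2 = -1" by (simp_all add: eps_def)
  show "T_tri L r a x = loop_operator (tri_coeff L r) a x"
    unfolding T_tri_def fiber_operator_def vec_to_fiber_def fiber_to_vec_def matrix_vector_mult_def
      loop_operator_def
    by (simp add: U mat_scale_def kron_def mat_unit_def path_index_def e loop_def tri_coeff_def)
qed

text \<open>Adding the expansions of \<open>sin (z + \<lambda>)\<close> and \<open>sin (z - \<lambda>)\<close> cancels the cosine terms in \<open>z\<close>.\<close>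

lemma bracket_neighbours:
  "bracket L (a + 1) + bracket L (a - 1) = of_real (2 * cos (pi / (real L + 1))) * bracket L a"
proof -
  let ?z = "of_real pi * a / (of_nat L + 1) :: complex" and ?l = "of_real (pi / (real L + 1)) :: complex"
  have "bracket L (a + 1) = sin (?z + ?l)" "bracket L (a - 1) = sin (?z - ?l)"
    by (simp_all add: bracket_def ring_distribs add_divide_distrib diff_divide_distrib)
  then show ?thesis
    unfolding bracket_def[of L a] sin_add sin_diff by (simp add: algebra_simps flip: cos_of_real)
qed

theorem proposition2p26:
  fixes L :: nat and b :: complex and r :: "complex \<Rightarrow> complex"
  assumes "L \<ge> 2"
    and "\<forall>a\<in>shifted_ints b. bracket L a \<noteq> 0"
    and "\<forall>a\<in>shifted_ints b. (r a)\<^sup>2 = bracket L (a - 1) * bracket L (a + 1)"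
  shows "local_dynamical_TL (pi_A_unres b) (V_A_unres b)
    (\<lambda>a. complex_of_real (2 * cos (pi / (real L + 1)))) (T_tri L r)"
  unfolding T_tri_eq_loop_operator
proof (rule local_dynamical_TL_loop_operator)
  fix a assume a: "a \<in> shifted_ints b"
  \<comment> \<open>\<open>L \<ge> 2\<close> places \<open>\<lambda>\<close> strictly between \<open>0\<close> and \<open>\<pi>/2\<close>; for \<open>L = 1\<close> the value \<open>2 cos \<lambda>\<close> would be \<open>0\<close>.\<close>
  have "pi / (real L + 1) < pi / 2" using \<open>L \<ge> 2\<close> by (intro divide_strict_left_mono) auto
  moreover have "0 < pi / (real L + 1)" by simp
  ultimately have "cos (pi / (real L + 1)) > 0" by (intro cos_gt_zero)
  then show "complex_of_real (2 * cos (pi / (real L + 1))) \<noteq> 0" by simp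
  have n: "bracket L a \<noteq> 0" using assms(2) a by blast
  have "bracket L (a + 1) / bracket L a + bracket L (a - 1) / bracket L a =
      complex_of_real (2 * cos (pi / (real L + 1)))"
    unfolding add_divide_distrib[symmetric] bracket_neighbours using n by simp
  then show "(\<Sum>\<epsilon>\<in>signs. tri_coeff L r a \<epsilon> \<epsilon>) = complex_of_real (2 * cos (pi / (real L + 1)))"
    by (simp add: tri_coeff_def)
next
  fix a \<epsilon> \<zeta> \<eta> assume a: "a \<in> shifted_ints b" and "\<epsilon> \<in> signs" "\<zeta> \<in> signs" "\<eta> \<in> signs"
  moreover have "r a * r a = bracket L (a - 1) * bracket L (a + 1)"
    using assms(3) a by (simp add: power2_eq_square)
  ultimately show "tri_coeff L r a \<epsilon> \<zeta> * tri_coeff L r a \<zeta> \<eta> =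
      tri_coeff L r a \<zeta> \<zeta> * tri_coeff L r a \<epsilon> \<eta>"
    by (auto simp: tri_coeff_def mult_ac)
next
  fix a \<epsilon> assume a: "a \<in> shifted_ints b" and "\<epsilon> \<in> signs"
  have "bracket L a \<noteq> 0" "bracket L (a + of_int \<epsilon>) \<noteq> 0"
    using assms(2) a shifted_ints_step[OF a, of \<epsilon>] by blast+
  then show "tri_coeff L r a \<epsilon> \<epsilon> * tri_coeff L r (a + of_int \<epsilon>) (- \<epsilon>) (- \<epsilon>) = 1"
    by (simp add: tri_coeff_def)
qed

end
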